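(* For every non-increasing continuous function $v\colon(0,+\infty)\to[0,+\infty)$ with $\lim_{x\to+\infty}v(x)=0$ there exist a Banach space $\mathcal{F}$, a $C_0$-semigroup $(e^{tL})_{t\ge0}$ in $\mathcal{F}$ with generator $(L,D(L))$, a Chernoff function $G$ for $L$, and a vector $f\in\mathcal{F}$ such that $f\notin D(L)$ but for all $T>0$ $$\sup_{t\in[0,T]}\|G(t/n)^nf-e^{tL}f\|=Tv(n/T)$$ for all $n=1,2,3,\dots$ such that $Tv(n/T)\le1$. Moreover, $\|e^{tL}\|=\|G(t)\|=\|f\|=1$ for all $t\ge0$.
   Context: Let $(e^{tL})_{t\ge0}$ be a $C_0$-semigroup with generator $L$ in a Banach space $\mathcal{F}$, and let $\mathscr{L}(\mathcal{F})$ be the space of bounded linear operators on $\mathcal{F}$. A mapping $S\colon[0,+\infty)\to\mathscr{L}(\mathcal{F})$ is called a Chernoff function for the operator $L$ iff for each $T>0$ and each $f\in\mathcal{F}$ one has $\lim_{n\to\infty}\sup_{t\in[0,T]}\|S(t/n)^nf-e^{tL}f\|=0$. *)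

theory Defs
  imports "HOL-Analysis.Analysis"
begin

text \<open>
  HOL cannot quantify over types of class \<open>banach\<close> inside a formula. A Banach space is therefore
  an object: a linear subspace \<open>F\<close> of an ambient real vector space, with its own norm \<open>N\<close>.
  If the ambient type carries a norm, that norm is not used. Only the values of \<open>N\<close> and of
  operators on \<open>F\<close>, and of operator families at times \<open>t \<ge> 0\<close>, are relevant.
  With the ambient type \<open>real \<Rightarrow>\<^sub>C real\<close>, whose Hamel dimension is that of the continuum, such
  pairs \<open>(F, N)\<close> cover, up to isometric isomorphism, all real Banach spaces of cardinality at most
  the continuum.
\<close>

definition norm_on :: "'a::real_vector set \<Rightarrow> ('a \<Rightarrow> real) \<Rightarrow> bool" where
  "norm_on F N \<longleftrightarrow>
     (\<forall>x\<in>F. 0 \<le> N x) \<and>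
     (\<forall>x\<in>F. N x = 0 \<longleftrightarrow> x = 0) \<and>
     (\<forall>c. \<forall>x\<in>F. N (c *\<^sub>R x) = \<bar>c\<bar> * N x) \<and>
     (\<forall>x\<in>F. \<forall>y\<in>F. N (x + y) \<le> N x + N y)"

definition banach_space_on :: "'a::real_vector set \<Rightarrow> ('a \<Rightarrow> real) \<Rightarrow> bool" where
  "banach_space_on F N \<longleftrightarrow>
     subspace F \<and> norm_on F N \<and>
     (\<forall>X::nat \<Rightarrow> 'a. (\<forall>n. X n \<in> F) \<longrightarrow>
        (\<forall>e>0. \<exists>M. \<forall>m\<ge>M. \<forall>n\<ge>M. N (X m - X n) < e) \<longrightarrow>
        (\<exists>x\<in>F. (\<lambda>n. N (X n - x)) \<longlonglongrightarrow> 0))"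

definition bounded_operator_on :: "'a::real_vector set \<Rightarrow> ('a \<Rightarrow> real) \<Rightarrow> ('a \<Rightarrow> 'a) \<Rightarrow> bool" where
  "bounded_operator_on F N A \<longleftrightarrow>
     (\<forall>x\<in>F. A x \<in> F) \<and>
     (\<forall>x\<in>F. \<forall>y\<in>F. A (x + y) = A x + A y) \<and>
     (\<forall>c. \<forall>x\<in>F. A (c *\<^sub>R x) = c *\<^sub>R A x) \<and>
     (\<exists>K. \<forall>x\<in>F. N (A x) \<le> K * N x)"

definition operator_norm_on :: "'a::real_vector set \<Rightarrow> ('a \<Rightarrow> real) \<Rightarrow> ('a \<Rightarrow> 'a) \<Rightarrow> real" where
  "operator_norm_on F N A = (SUP x\<in>{x\<in>F. N x \<le> 1}. N (A x))"

definition C0_semigroup_on ::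
    "'a::real_vector set \<Rightarrow> ('a \<Rightarrow> real) \<Rightarrow> (real \<Rightarrow> 'a \<Rightarrow> 'a) \<Rightarrow> bool" where
  "C0_semigroup_on F N S \<longleftrightarrow>
     (\<forall>t\<ge>0. bounded_operator_on F N (S t)) \<and>
     (\<forall>x\<in>F. S 0 x = x) \<and>
     (\<forall>s\<ge>0. \<forall>t\<ge>0. \<forall>x\<in>F. S (s + t) x = S s (S t x)) \<and>
     (\<forall>x\<in>F. \<forall>t0\<ge>0. ((\<lambda>t. N (S t x - S t0 x)) \<longlongrightarrow> 0) (at t0 within {0..}))"

definition generator_limit ::
    "('a::real_vector \<Rightarrow> real) \<Rightarrow> (real \<Rightarrow> 'a \<Rightarrow> 'a) \<Rightarrow> 'a \<Rightarrow> 'a \<Rightarrow> bool" where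
  "generator_limit N S x y \<longleftrightarrow>
     ((\<lambda>h. N ((1 / h) *\<^sub>R (S h x - x) - y)) \<longlongrightarrow> 0) (at_right 0)"

text \<open>\<open>(L, D)\<close> is the generator of \<open>S\<close>, with its full domain \<open>D\<close>.\<close>

definition is_generator_on ::
    "'a::real_vector set \<Rightarrow> ('a \<Rightarrow> real) \<Rightarrow> (real \<Rightarrow> 'a \<Rightarrow> 'a) \<Rightarrow> ('a \<Rightarrow> 'a) \<Rightarrow> 'a set \<Rightarrow> bool" where
  "is_generator_on F N S L D \<longleftrightarrow>
     D = {x\<in>F. \<exists>y\<in>F. generator_limit N S x y} \<and>
     (\<forall>x\<in>D. L x \<in> F \<and> generator_limit N S x (L x))"

text \<open>
  The supremum is taken in \<open>ereal\<close>, since it may be infinite for a general \<open>G\<close>. The value at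
  \<open>n = 0\<close> is junk and does not affect the limit.
\<close>

definition chernoff_error ::
    "('a::real_vector \<Rightarrow> real) \<Rightarrow> (real \<Rightarrow> 'a \<Rightarrow> 'a) \<Rightarrow> (real \<Rightarrow> 'a \<Rightarrow> 'a) \<Rightarrow> 'a \<Rightarrow> real \<Rightarrow> nat \<Rightarrow> ereal" where
  "chernoff_error N S G f T n =
     (SUP t\<in>{0..T}. ereal (N ((G (t / real n) ^^ n) f - S t f)))"

text \<open>\<open>G\<close> is a Chernoff function for \<open>L\<close>, where \<open>S t\<close> stands for \<open>e\<^bsup>tL\<^esup>\<close>.\<close>

definition chernoff_function_on ::
    "'a::real_vector set \<Rightarrow> ('a \<Rightarrow> real) \<Rightarrow> (real \<Rightarrow> 'a \<Rightarrow> 'a) \<Rightarrow> (real \<Rightarrow> 'a \<Rightarrow> 'a) \<Rightarrow> bool" where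
  "chernoff_function_on F N S G \<longleftrightarrow>
     (\<forall>t\<ge>0. bounded_operator_on F N (G t)) \<and>
     (\<forall>T>0. \<forall>f\<in>F. (\<lambda>n. chernoff_error N S G f T n) \<longlonglongrightarrow> 0)"

end

theory Submission
  imports Defs "HOL-Real_Asymp.Real_Asymp"
begin

text \<open>
  Let \<open>\<F>\<close> be the bounded uniformly continuous functions on the line with the
  supremum norm and let \<open>e\<^bsup>tL\<^esup>\<close> be the translation by \<open>t\<close>. Put
  \<open>G(t)\<close> = translation by \<open>t + t v(1/t)\<close>; then \<open>G(t/n)\<^sup>n\<close> is the translation by
  \<open>t + t v(n/t)\<close>, so the error on \<open>f\<close> at time \<open>t\<close> is the distance from \<open>f\<close> to its translate by
  \<open>t v(n/t)\<close>. For the tent function \<open>f(x) = max 0 (1 - |x|)\<close> this distance is \<open>t v(n/t)\<close>, as long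
  as that number is at most 1, and it is non-decreasing in \<open>t\<close>. The tent is not differentiable
  at 0, hence not in the domain of \<open>L\<close>.
\<close>

section \<open>Closed subspaces and isometries\<close>

lemma banach_space_on_closed_subspace:
  fixes F :: "'a::{real_normed_vector, complete_space} set"
  assumes "subspace F" and "closed F"
  shows "banach_space_on F norm"
  unfolding banach_space_on_def
proof (intro conjI allI impI)
  show "norm_on F norm"
    by (simp add: norm_on_def norm_triangle_ineq)
  fix X :: "nat \<Rightarrow> 'a"
  assume X: "\<forall>n. X n \<in> F" and "\<forall>e>0. \<exists>M. \<forall>m\<ge>M. \<forall>n\<ge>M. norm (X m - X n) < e"
  then have "Cauchy X"
    by (simp add: Cauchy_def dist_norm)
  then obtain x where x: "X \<longlonglongrightarrow> x"
    using Cauchy_convergent convergent_def by blast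
  then have "x \<in> F"
    using X \<open>closed F\<close> closed_sequentially by blast
  then show "\<exists>x\<in>F. (\<lambda>n. norm (X n - x)) \<longlonglongrightarrow> 0"
    using x LIM_zero tendsto_norm_zero by blast
qed (fact assms)

text \<open>An isometry maps the unit ball to values of norm at most 1, and the unit vector
  \<open>x0\<close> attains this bound.\<close>

lemma operator_norm_on_isometry:
  assumes "\<And>x. x \<in> F \<Longrightarrow> N (A x) = N x" and "x0 \<in> F" and "N x0 = 1"
  shows "operator_norm_on F N A = 1"
  unfolding operator_norm_on_def
  by (rule cSup_eq_maximum) (use assms in \<open>auto intro!: image_eqI[of _ _ x0]\<close>)

section \<open>Translations of bounded continuous functions\<close>

definition translate ::
    "'a::real_normed_vector \<Rightarrow> ('a \<Rightarrow>\<^sub>C 'b::real_normed_vector) \<Rightarrow> ('a \<Rightarrow>\<^sub>C 'b)" where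
  "translate a f = Bcontfun (\<lambda>x. apply_bcontfun f (x + a))"

lemma apply_translate [simp]: "apply_bcontfun (translate a f) x = apply_bcontfun f (x + a)"
proof -
  have "(\<lambda>x. apply_bcontfun f (x + a)) \<in> bcontfun"
  proof (rule bcontfun_normI)
    show "continuous_on UNIV (\<lambda>x. apply_bcontfun f (x + a))"
      by (rule continuous_on_compose2[OF continuous_on_apply_bcontfun[of UNIV f]])
        (auto intro: continuous_intros)
  qed (rule norm_bounded)
  then show ?thesis
    by (simp add: translate_def Bcontfun_inverse)
qed

lemma translate_0 [simp]: "translate 0 f = f"
  by (rule bcontfun_eqI) simp

lemma translate_translate [simp]: "translate a (translate b f) = translate (a + b) f"
  by (rule bcontfun_eqI) (simp add: algebra_simps)

lemma translate_add: "translate a (f + g) = translate a f + translate a g"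
  by (rule bcontfun_eqI) simp

lemma translate_diff: "translate a (f - g) = translate a f - translate a g"
  by (rule bcontfun_eqI) simp

lemma translate_scaleR: "translate a (c *\<^sub>R f) = c *\<^sub>R translate a f"
  by (rule bcontfun_eqI) simp

lemma norm_translate [simp]: "norm (translate a f) = norm f"
proof (rule antisym)
  \<comment> \<open>Stated for an arbitrary shift, since the reverse inequality comes from undoing
    the translation with \<open>- a\<close>.\<close>
  have le: "norm (translate b g) \<le> norm g" for b and g :: "'a \<Rightarrow>\<^sub>C 'b"
    by (rule norm_bound) (simp add: norm_bounded)
  show "norm (translate a f) \<le> norm f"
    by (rule le)
  show "norm f \<le> norm (translate a f)"
    using le[of "- a" "translate a f"] by simp
qed

text \<open>Factoring out the isometry \<open>translate a\<close> leaves only the excess shift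
  \<open>b\<close>; this later turns the Chernoff error into the distance from \<open>f\<close> to a
  translate of itself.\<close>

lemma norm_translate_diff:
  "norm (translate (a + b) f - translate a f) = norm (translate b f - f)"
proof -
  have "translate (a + b) f - translate a f = translate a (translate b f - f)"
    by (simp add: translate_diff)
  then show ?thesis
    by simp
qed

lemma translate_funpow: "(translate a ^^ n) f = translate (real n *\<^sub>R a) f"
  by (induction n) (simp_all add: algebra_simps)

section \<open>The space of bounded uniformly continuous functions\<close>

definition buc :: "('a::real_normed_vector \<Rightarrow>\<^sub>C 'b::real_normed_vector) set" where
  "buc = {f. uniformly_continuous_on UNIV (apply_bcontfun f)}"

lemma subspace_buc: "subspace buc"
  by (rule subspaceI) (auto simp: buc_def zero_bcontfun.rep_eq[abs_def]
      plus_bcontfun.rep_eq[abs_def] scaleR_bcontfun.rep_eq[abs_def] intro!: continuous_intros)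

text \<open>The points \<open>x + a\<close> and \<open>x + b\<close> are as far apart as
  \<open>a\<close> and \<open>b\<close>, for every \<open>x\<close>, so a uniform modulus of
  continuity bounds the supremum norm. Passing to the supremum loses strictness.\<close>

lemma buc_translate_close:
  assumes "f \<in> buc" and "e > 0"
  obtains d where "d > 0" and "\<And>a b. norm (a - b) < d \<Longrightarrow> norm (translate a f - translate b f) \<le> e"
proof -
  obtain d where "d > 0" and d: "\<And>x y. dist y x < d \<Longrightarrow> dist (apply_bcontfun f y) (apply_bcontfun f x) < e"
    using assms unfolding buc_def uniformly_continuous_on_def by blast
  have "norm (translate a f - translate b f) \<le> e" if "norm (a - b) < d" for a b
  proof (rule norm_bound)
    fix x
    have "dist (x + a) (x + b) < d"
      using that by (simp add: dist_norm)
    from d[OF this] show "norm (apply_bcontfun (translate a f - translate b f) x) \<le> e"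
      by (simp add: dist_norm)
  qed
  with \<open>d > 0\<close> show ?thesis
    by (rule that)
qed

text \<open>The usual three-epsilon argument: convergence in the supremum norm is uniform
  convergence.\<close>

lemma closed_buc: "closed buc"
  unfolding closed_sequential_limits
proof (intro allI impI)
  fix X :: "nat \<Rightarrow> 'a \<Rightarrow>\<^sub>C 'b" and f
  assume asm: "(\<forall>n. X n \<in> buc) \<and> X \<longlonglongrightarrow> f"
  have "\<exists>d>0. \<forall>x y. dist y x < d \<longrightarrow> dist (apply_bcontfun f y) (apply_bcontfun f x) < e" if "e > 0" for e
  proof -
    have "\<forall>\<^sub>F n in sequentially. dist (X n) f < e / 3"
      using asm \<open>e > 0\<close> by (intro tendstoD) auto
    then obtain n where n: "dist (X n) f < e / 3"
      by (auto simp: eventually_sequentially)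
    have "X n \<in> buc" and "e / 3 > 0"
      using asm \<open>e > 0\<close> by auto
    then obtain d where "d > 0" and d: "\<And>x y. dist y x < d \<Longrightarrow> dist (apply_bcontfun (X n) y) (apply_bcontfun (X n) x) < e / 3"
      unfolding buc_def uniformly_continuous_on_def by blast
    have "dist (apply_bcontfun f y) (apply_bcontfun f x) < e" if "dist y x < d" for x y
      by (rule dist_triangle_third[of _ "apply_bcontfun (X n) y" _ "apply_bcontfun (X n) x"])
        (use d[OF that] dist_fun_lt_imp_dist_val_lt[OF n] in \<open>simp_all add: dist_commute\<close>)
    with \<open>d > 0\<close> show ?thesis
      by blast
  qed
  then show "f \<in> buc"
    by (simp add: buc_def uniformly_continuous_on_def)
qed

lemma translate_buc: "f \<in> buc \<Longrightarrow> translate a f \<in> buc"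
  unfolding buc_def mem_Collect_eq uniformly_continuous_on_def apply_translate
  by (metis UNIV_I dist_add_cancel2)

lemma bounded_operator_translate: "bounded_operator_on buc norm (translate a)"
  unfolding bounded_operator_on_def
  by (auto simp: translate_buc translate_add translate_scaleR intro!: exI[of _ 1])

section \<open>The translation semigroup, its generator and its Chernoff functions\<close>

lemma C0_semigroup_translate:
  "C0_semigroup_on (buc :: (real \<Rightarrow>\<^sub>C 'b::real_normed_vector) set) norm translate"
  unfolding C0_semigroup_on_def
proof (intro conjI ballI allI impI)
  fix f :: "real \<Rightarrow>\<^sub>C 'b" and t0 :: real
  assume f: "f \<in> buc"
  show "((\<lambda>t. norm (translate t f - translate t0 f)) \<longlongrightarrow> 0) (at t0 within {0..})"
  proof (rule tendstoI)
    fix e :: real assume "e > 0"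
    \<comment> \<open>Half of \<open>e\<close>, because the closeness bound is not strict and the
      limit asks for a strict one.\<close>
    then obtain d where "d > 0"
      and d: "\<And>a b. norm (a - b) < d \<Longrightarrow> norm (translate a f - translate b f) \<le> e / 2"
      using buc_translate_close[OF f, of "e / 2"] by auto
    have "\<forall>\<^sub>F t in at t0 within {0..}. dist t t0 < d"
      using \<open>d > 0\<close> by (auto simp: eventually_at)
    then show "\<forall>\<^sub>F t in at t0 within {0..}. dist (norm (translate t f - translate t0 f)) 0 < e"
    proof eventually_elim
      case (elim t)
      with d[of t t0] \<open>e > 0\<close> show ?case
        by (simp add: dist_norm)
    qed
  qed
qed (simp_all add: bounded_operator_translate)

text \<open>Evaluation at \<open>x\<close> is dominated by the supremum norm, so a norm limit of
  difference quotients is a pointwise one: \<open>g\<close> is the right derivative of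
  \<open>f\<close>.\<close>

lemma generator_limit_translate_pointwise:
  assumes "generator_limit norm translate f g"
  shows "((\<lambda>h. (1 / h) *\<^sub>R (apply_bcontfun f (x + h) - apply_bcontfun f x)) \<longlongrightarrow> apply_bcontfun g x) (at_right 0)"
proof -
  have "((\<lambda>h. norm (apply_bcontfun ((1 / h) *\<^sub>R (translate h f - f) - g) x)) \<longlongrightarrow> 0) (at_right 0)"
    by (rule tendsto_sandwich[OF _ _ tendsto_const assms[unfolded generator_limit_def]])
      (auto intro!: always_eventually simp: norm_bounded simp del: minus_bcontfun.rep_eq scaleR_bcontfun.rep_eq)
  then have "((\<lambda>h. (1 / h) *\<^sub>R (apply_bcontfun f (x + h) - apply_bcontfun f x) - apply_bcontfun g x) \<longlongrightarrow> 0) (at_right 0)"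
    by (simp add: tendsto_norm_zero_iff)
  then show ?thesis
    by (rule LIM_zero_cancel)
qed

text \<open>The \<open>n\<close>-th power is the translation by \<open>n * \<sigma> (t / n)\<close>,
  so convergence of these shifts to \<open>t\<close>, uniform on \<open>{0..T}\<close>, suffices by
  uniform continuity of \<open>f\<close>.\<close>

lemma chernoff_function_translate:
  fixes \<sigma> :: "real \<Rightarrow> real"
  assumes "\<And>T e. T > 0 \<Longrightarrow> e > 0 \<Longrightarrow>
    \<forall>\<^sub>F n in sequentially. \<forall>t\<in>{0..T}. \<bar>real n * \<sigma> (t / real n) - t\<bar> < e"
  shows "chernoff_function_on (buc :: (real \<Rightarrow>\<^sub>C 'b::real_normed_vector) set) norm
    translate (\<lambda>t. translate (\<sigma> t))"
  unfolding chernoff_function_on_def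
proof (intro conjI allI ballI impI)
  fix T :: real and f :: "real \<Rightarrow>\<^sub>C 'b"
  assume "T > 0" and f: "f \<in> buc"
  let ?err = "chernoff_error norm translate (\<lambda>t. translate (\<sigma> t)) f T"
  show "?err \<longlonglongrightarrow> 0"
  proof (rule order_tendstoI)
    fix a :: ereal assume "a < 0"
    have "0 \<le> ?err n" for n
      unfolding chernoff_error_def using \<open>T > 0\<close> by (intro SUP_upper2[of 0]) auto
    with \<open>a < 0\<close> show "\<forall>\<^sub>F n in sequentially. a < ?err n"
      by (intro always_eventually) (auto intro: less_le_trans)
  next
    fix a :: ereal assume "0 < a"
    \<comment> \<open>The bound \<open>a\<close> may be infinite; a real \<open>e\<close> strictly
      below it also absorbs the non-strict estimate.\<close>
    then obtain e where e: "0 < e" "ereal e < a"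
      using ereal_dense2[of 0 a] by (auto simp: zero_ereal_def)
    obtain d where "d > 0"
      and d: "\<And>a b. norm (a - b) < d \<Longrightarrow> norm (translate a f - translate b f) \<le> e"
      using buc_translate_close[OF f \<open>0 < e\<close>] by auto
    show "\<forall>\<^sub>F n in sequentially. ?err n < a"
      using assms[OF \<open>T > 0\<close> \<open>d > 0\<close>]
    proof eventually_elim
      case (elim n)
      have "?err n \<le> ereal e"
        unfolding chernoff_error_def translate_funpow
        by (rule SUP_least) (use elim d in auto)
      with e show ?case
        by simp
    qed
  qed
qed (rule bounded_operator_translate)

section \<open>The tent function\<close>

definition tent :: "real \<Rightarrow>\<^sub>C real" where
  "tent = Bcontfun (\<lambda>x. max 0 (1 - \<bar>x\<bar>))"

lemma apply_tent [simp]: "apply_bcontfun tent x = max 0 (1 - \<bar>x\<bar>)"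
proof -
  have "(\<lambda>x::real. max 0 (1 - \<bar>x\<bar>)) \<in> bcontfun"
    by (rule bcontfun_normI[where b = 1]) (auto intro!: continuous_intros)
  then show ?thesis
    by (simp add: tent_def Bcontfun_inverse)
qed

lemma norm_tent: "norm tent = 1"
  using norm_bounded[of tent 0] by (intro antisym norm_bound) auto

lemma tent_buc: "tent \<in> buc"
  unfolding buc_def uniformly_continuous_on_def dist_real_def apply_tent
  by (auto intro!: exI)

text \<open>The tent is 1-Lipschitz, which gives the upper bound; at its peak 0 the value drops by
  exactly \<open>s\<close>, as long as \<open>s\<close> is at most 1.\<close>

lemma norm_translate_tent_diff:
  assumes "0 \<le> s" and "s \<le> 1"
  shows "norm (translate s tent - tent) = s"
proof (rule antisym)
  show "norm (translate s tent - tent) \<le> s"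
    by (rule norm_bound) (use assms in auto)
  show "s \<le> norm (translate s tent - tent)"
    using norm_bounded[of "translate s tent - tent" 0] assms by simp
qed

text \<open>The limit \<open>g\<close> would be the right derivative: 1 on the interval from -1 to
  0, but -1 at 0. This contradicts the continuity of \<open>g\<close>.\<close>

lemma tent_not_generator_limit: "\<not> generator_limit norm translate tent g"
proof
  assume lim: "generator_limit norm translate tent g"
  note pw = generator_limit_translate_pointwise[OF lim]
  have "apply_bcontfun g 0 = - 1"
  proof (rule tendsto_unique[OF _ pw])
    have "\<forall>\<^sub>F h in at_right (0::real). - 1 = (1 / h) *\<^sub>R (apply_bcontfun tent (0 + h) - apply_bcontfun tent 0)"
      by (rule eventually_at_rightI[of 0 1]) auto
    then show "((\<lambda>h. (1 / h) *\<^sub>R (apply_bcontfun tent (0 + h) - apply_bcontfun tent 0)) \<longlongrightarrow> - 1) (at_right 0)"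
      by (rule Lim_transform_eventually[OF tendsto_const])
  qed simp
  moreover have left: "apply_bcontfun g x = 1" if "-1 < x" "x < 0" for x
  proof (rule tendsto_unique[OF _ pw])
    have "\<forall>\<^sub>F h in at_right (0::real). 1 = (1 / h) *\<^sub>R (apply_bcontfun tent (x + h) - apply_bcontfun tent x)"
      \<comment> \<open>For \<open>h\<close> below \<open>- x\<close> the point \<open>x + h\<close>
        stays on the rising side, where the quotient is exactly 1.\<close>
      by (rule eventually_at_rightI[of 0 "- x"]) (use that in auto)
    then show "((\<lambda>h. (1 / h) *\<^sub>R (apply_bcontfun tent (x + h) - apply_bcontfun tent x)) \<longlongrightarrow> 1) (at_right 0)"
      by (rule Lim_transform_eventually[OF tendsto_const])
  qed simp
  have "apply_bcontfun g 0 = 1"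
  proof (rule tendsto_unique)
    show "(apply_bcontfun g \<longlongrightarrow> apply_bcontfun g 0) (at_left 0)"
      by (rule tendsto_within_subset[OF _ subset_UNIV])
        (use continuous_on_apply_bcontfun[of UNIV g, unfolded continuous_on_def] in blast)
    have "\<forall>\<^sub>F x in at_left (0::real). 1 = apply_bcontfun g x"
      by (rule eventually_at_leftI[of "-1"]) (use left in auto)
    then show "(apply_bcontfun g \<longlongrightarrow> 1) (at_left 0)"
      by (rule Lim_transform_eventually[OF tendsto_const])
  qed simp
  ultimately show False
    by simp
qed

section \<open>Shifts built from \<open>v\<close> and the exact error on the tent\<close>

theorem proposition2p4:
  fixes v :: "real \<Rightarrow> real"
  assumes "continuous_on {0<..} v"
    and "antimono_on {0<..} v"
    and "\<And>x. 0 < x \<Longrightarrow> 0 \<le> v x"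
    and "(v \<longlongrightarrow> 0) at_top"
  shows "\<exists>(F :: (real \<Rightarrow>\<^sub>C real) set) N S L D G f.
           banach_space_on F N \<and>
           C0_semigroup_on F N S \<and>
           is_generator_on F N S L D \<and>
           chernoff_function_on F N S G \<and>
           f \<in> F \<and> f \<notin> D \<and>
           (\<forall>T>0. \<forall>n\<ge>1. T * v (real n / T) \<le> 1 \<longrightarrow>
              (SUP t\<in>{0..T}. ereal (N ((G (t / real n) ^^ n) f - S t f))) = ereal (T * v (real n / T))) \<and>
           (\<forall>t\<ge>0. operator_norm_on F N (S t) = 1 \<and> operator_norm_on F N (G t) = 1) \<and>
           N f = 1"
proof -
  define F :: "(real \<Rightarrow>\<^sub>C real) set" where "F = buc"
  \<comment> \<open>At \<open>t = 0\<close> the junk value \<open>v (1 / 0) = v 0\<close> is multiplied by 0.\<close>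
  define \<sigma> where "\<sigma> t = t + t * v (1 / t)" for t
  define D where "D = {x\<in>F. \<exists>y\<in>F. generator_limit norm translate x y}"
  define L where "L x = (SOME y. y \<in> F \<and> generator_limit norm translate x y)" for x
  \<comment> \<open>Thus \<open>n\<close> steps of length \<open>t / n\<close> overshoot
    \<open>t\<close> by exactly \<open>t * v (n / t)\<close>.\<close>
  have \<sigma>: "real n * \<sigma> (t / real n) = t + t * v (real n / t)" if "n \<ge> 1" for n t
    using that by (simp add: \<sigma>_def field_simps)
  have shift_nonneg: "0 \<le> t * v (real n / t)" if "0 \<le> t" "n \<ge> 1" for n t
    using that assms(3)[of "real n / t"] by (cases "t = 0") auto
  have shift_mono: "t * v (real n / t) \<le> T * v (real n / T)" if "0 \<le> t" "t \<le> T" "n \<ge> 1" for n t T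
  \<comment> \<open>For \<open>t = 0\<close> the quotient \<open>n / t\<close> is 0 by default,
    outside the set where \<open>v\<close> is monotone. For \<open>t > 0\<close> both factors grow
    with \<open>t\<close>, as \<open>n / t\<close> decreases.\<close>
  proof (cases "t = 0")
    case True
    with that shift_nonneg[of T n] show ?thesis by simp
  next
    case False
    with that have "v (real n / t) \<le> v (real n / T)"
      by (intro monotone_onD[OF assms(2)]) (auto intro!: divide_left_mono mult_pos_pos)
    with that False assms(3)[of "real n / t"] show ?thesis
      by (intro mult_mono) auto
  qed
  have err: "(SUP t\<in>{0..T}. ereal (norm (((translate (\<sigma> (t / real n))) ^^ n) tent - translate t tent)))
      = ereal (T * v (real n / T))" if "T > 0" "n \<ge> 1" and le: "T * v (real n / T) \<le> 1" for T n
  proof -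
    \<comment> \<open>The overshoot at \<open>t\<close> is at most the one at \<open>T\<close>,
      hence at most 1, where the displacement of the tent equals the shift.\<close>
    have "norm (((translate (\<sigma> (t / real n))) ^^ n) tent - translate t tent) = t * v (real n / t)"
      if "t \<in> {0..T}" for t
      using that \<open>n \<ge> 1\<close> le shift_nonneg[of t n] shift_mono[of t T n]
      by (simp add: translate_funpow \<sigma> norm_translate_diff norm_translate_tent_diff)
    then have "(SUP t\<in>{0..T}. ereal (norm (((translate (\<sigma> (t / real n))) ^^ n) tent - translate t tent)))
        = (SUP t\<in>{0..T}. ereal (t * v (real n / t)))"
      by (intro SUP_cong) auto
    also have "\<dots> = ereal (T * v (real n / T))"
      \<comment> \<open>The supremum is attained at \<open>t = T\<close>.\<close>
      by (rule antisym[OF SUP_least SUP_upper]) (use that shift_mono in auto)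
    finally show ?thesis .
  qed
  have "chernoff_function_on F norm translate (\<lambda>t. translate (\<sigma> t))"
    unfolding F_def
  proof (rule chernoff_function_translate)
    fix T e :: real assume "T > 0" "e > 0"
    \<comment> \<open>By monotonicity the overshoot at \<open>T\<close> controls all
      \<open>t\<close> in \<open>{0..T}\<close>, so uniformity reduces to the decay of
      \<open>v\<close> along \<open>n / T\<close>.\<close>
    have "filterlim (\<lambda>n. real n / T) at_top sequentially"
      using \<open>T > 0\<close> by real_asymp
    then have "(\<lambda>n. T * v (real n / T)) \<longlonglongrightarrow> T * 0"
      by (intro tendsto_mult tendsto_const filterlim_compose[OF assms(4)])
    then have "\<forall>\<^sub>F n in sequentially. T * v (real n / T) < e"
      using \<open>e > 0\<close> by (intro order_tendstoD) auto
    then show "\<forall>\<^sub>F n in sequentially. \<forall>t\<in>{0..T}. \<bar>real n * \<sigma> (t / real n) - t\<bar> < e"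
      using eventually_ge_at_top[of 1]
    proof eventually_elim
      case (elim n)
      show ?case
      proof
        fix t assume "t \<in> {0..T}"
        with elim shift_nonneg[of t n] shift_mono[of t T n]
        show "\<bar>real n * \<sigma> (t / real n) - t\<bar> < e"
          by (simp add: \<sigma>)
      qed
    qed
  qed
  moreover have "banach_space_on F norm"
    unfolding F_def by (intro banach_space_on_closed_subspace subspace_buc closed_buc)
  moreover have "C0_semigroup_on F norm translate"
    unfolding F_def by (rule C0_semigroup_translate)
  moreover have "is_generator_on F norm translate L D"
    unfolding is_generator_on_def
  proof (intro conjI ballI)
    show "D = {x\<in>F. \<exists>y\<in>F. generator_limit norm translate x y}"
      by (rule D_def)
    fix x assume "x \<in> D"
    then have "\<exists>y. y \<in> F \<and> generator_limit norm translate x y"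
      unfolding D_def by blast
    from someI_ex[OF this] show "L x \<in> F" "generator_limit norm translate x (L x)"
      unfolding L_def by auto
  qed
  moreover have "tent \<in> F" "tent \<notin> D"
    by (simp_all add: F_def D_def tent_buc tent_not_generator_limit)
  \<comment> \<open>Covers the semigroup and the Chernoff function at once, both consisting of
    translations.\<close>
  moreover have "operator_norm_on F norm (translate a) = 1" for a
    by (rule operator_norm_on_isometry[of _ _ _ tent]) (simp_all add: F_def tent_buc norm_tent)
  ultimately show ?thesis
    using err norm_tent
    by (intro exI[of _ F] exI[of _ norm] exI[of _ translate] exI[of _ L] exI[of _ D]
        exI[of _ "\<lambda>t. translate (\<sigma> t)"] exI[of _ tent]) simp
qed

end
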